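(* Let $\epsilon\in[0,1)$, $t_0^s\in\mathbb{R}$, and let $n\ge k\ge2$ be integers. Let $\tilde B$ and $\tilde{\tilde B}$ be sums of $k$, respectively $k+1$, i.i.d. geometric random variables on $\{1,2,\dots\}$ with success probability $1-\epsilon$, and let $$\Delta^{lb}_{\epsilon,(n,k)}=\frac{k\,\mathbb{P}(\tilde{\tilde B}\le n+1)}{(1-\epsilon)\mathbb{P}(\tilde B\le n)}-1+\frac{n\,(2-\mathbb{P}(\tilde B\le n))}{2\,\mathbb{P}(\tilde B\le n)}+[-t_0^s].$$ Then $$\Delta^{lb}_{\epsilon,(n,k)}\le\Delta^{*}_{\epsilon,(n,k)}:=\frac{k}{1-\epsilon}-1+\frac{n\,(2-\mathbb{P}(\tilde B\le n))}{2\,\mathbb{P}(\tilde B\le n)}+[-t_0^s].$$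
   Context: $[x]=x-\lfloor x\rfloor$ is the fractional part of $x$. A geometric variable with success probability $p$ satisfies $\mathbb{P}(L=i)=(1-p)^{i-1}p$ for $i\ge1$. *)

theory Defs
  imports "HOL-Probability.Probability"
begin

definition geometric_var :: "'a measure \<Rightarrow> real \<Rightarrow> ('a \<Rightarrow> nat) \<Rightarrow> bool" where
  "geometric_var M p L \<longleftrightarrow>
     L \<in> measurable M (count_space UNIV) \<and>
     (\<forall>i\<ge>1. \<P>(\<omega> in M. L \<omega> = i) = (1 - p) ^ (i - 1) * p)"

text \<open>For \<open>0 < p\<close> and \<open>p \<le> 1\<close> the prescribed masses at \<open>1, 2, \<dots>\<close> sum to \<open>1\<close>, so a geometric
  variable takes the value \<open>0\<close> with probability \<open>0\<close>.\<close>

definition iid_geometric :: "'a measure \<Rightarrow> real \<Rightarrow> (nat \<Rightarrow> 'a \<Rightarrow> nat) \<Rightarrow> nat set \<Rightarrow> bool" where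
  "iid_geometric M p L I \<longleftrightarrow>
     prob_space.indep_vars M (\<lambda>_. count_space UNIV) L I \<and>
     (\<forall>j\<in>I. geometric_var M p (L j))"

text \<open>In the next two definitions \<open>B\<close> and \<open>BB\<close> are the sums of \<open>k\<close> and \<open>k + 1\<close> geometric
  variables. They may live on different probability spaces \<open>M\<close> and \<open>N\<close>, since no joint
  distribution of the two is specified. The library function \<^const>\<open>frac\<close> is the fractional
  part \<open>x - \<lfloor>x\<rfloor>\<close>.\<close>

definition Delta_lb ::
  "'a measure \<Rightarrow> ('a \<Rightarrow> nat) \<Rightarrow> 'b measure \<Rightarrow> ('b \<Rightarrow> nat) \<Rightarrow> real \<Rightarrow> nat \<Rightarrow> nat \<Rightarrow> real \<Rightarrow> real" where
  "Delta_lb M B N BB \<epsilon> n k t =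
     real k * \<P>(\<omega> in N. BB \<omega> \<le> n + 1) / ((1 - \<epsilon>) * \<P>(\<omega> in M. B \<omega> \<le> n)) - 1
     + real n * (2 - \<P>(\<omega> in M. B \<omega> \<le> n)) / (2 * \<P>(\<omega> in M. B \<omega> \<le> n))
     + frac (- t)"

definition Delta_star ::
  "'a measure \<Rightarrow> ('a \<Rightarrow> nat) \<Rightarrow> real \<Rightarrow> nat \<Rightarrow> nat \<Rightarrow> real \<Rightarrow> real" where
  "Delta_star M B \<epsilon> n k t =
     real k / (1 - \<epsilon>) - 1
     + real n * (2 - \<P>(\<omega> in M. B \<omega> \<le> n)) / (2 * \<P>(\<omega> in M. B \<omega> \<le> n))
     + frac (- t)"

end

(* The two sides differ only by the factor P(BB <= n + 1) / P(B <= n), so it suffices that this is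
   at most 1. The last summand of BB is almost surely at least 1, so BB <= n + 1 forces the first k
   summands to add up to at most n, and their sum has the law of B, although it may live on a
   different probability space. *)
theory Submission
  imports Defs
begin

text \<open>\<open>geometric_pmf\<close> counts failures and starts at 0, hence the shift by
  \<open>Suc\<close>. The masses at i \<ge> 1 agree and already add up to 1, so both laws live on
  the countable set \<open>{1..}\<close> and are determined by its singletons.\<close>

lemma distr_geometric_var:
  assumes "prob_space M" and "0 < p" and "p \<le> 1" and "geometric_var M p L"
  shows "distr M (count_space UNIV) L = measure_pmf (map_pmf Suc (geometric_pmf p))"
    (is "?D = measure_pmf ?Q")
proof -
  interpret M: prob_space M by fact
  have meas [measurable]: "L \<in> measurable M (count_space UNIV)"
    and mass: "\<And>i. 1 \<le> i \<Longrightarrow> \<P>(\<omega> in M. L \<omega> = i) = (1 - p) ^ (i - 1) * p"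
    using assms(4) by (auto simp: geometric_var_def)
  interpret D: prob_space ?D by (rule M.prob_space_distr) (rule meas)
  have p: "p \<in> {0<..1}" using assms by auto
  have pos: "emeasure ?D {i} = emeasure ?Q {i}" if "1 \<le> i" for i
  proof -
    have "measure ?D {i} = \<P>(\<omega> in M. L \<omega> = i)"
      by (subst measure_distr) (auto intro!: arg_cong[where f = "measure M"])
    also have "\<dots> = (1 - p) ^ (i - 1) * p" by (rule mass[OF that])
    also have "\<dots> = pmf ?Q (Suc (i - 1))"
      by (subst pmf_map_inj') (use p in auto)
    finally show ?thesis
      using that by (simp add: D.emeasure_eq_measure measure_pmf.emeasure_eq_measure pmf.rep_eq)
  qed
  \<comment> \<open>\<open>geometric_var\<close> prescribes no mass at 0. That 0 is a null value is
    read off from \<open>?Q\<close>, which gives \<open>{1..}\<close> full mass.\<close>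
  have "emeasure ?D {1..} = emeasure ?Q {1..}"
    by (subst (1 2) emeasure_countable_singleton) (auto intro!: nn_integral_cong simp: pos)
  also have "\<dots> = 1"
    by (subst measure_pmf.emeasure_eq_1_AE) (auto simp: AE_measure_pmf_iff)
  finally have "AE x in ?D. x \<in> {1..}"
    by (subst D.AE_in_set_eq_1) (auto simp: D.emeasure_eq_measure)
  then show ?thesis
    by (intro measure_eqI_countable_AE[where \<Omega> = "{1..}"])
      (auto simp: AE_measure_pmf_iff pos)
qed

text \<open>Independence makes the joint law the product of the marginals, all of which are known.
  The right-hand side does not mention \<open>M\<close>, so sums on different spaces can be compared
  through it.\<close>

lemma distr_sum_iid_geometric:
  assumes "prob_space M" and "0 < p" and "p \<le> 1" and "iid_geometric M p L I"
    and "I \<noteq> {}"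
  shows "distr M (count_space UNIV) (\<lambda>\<omega>. \<Sum>j\<in>I. L j \<omega>) =
    distr (PiM I (\<lambda>_. measure_pmf (map_pmf Suc (geometric_pmf p)))) (count_space UNIV)
      (\<lambda>f. \<Sum>j\<in>I. f j)"
    (is "_ = distr (PiM I (\<lambda>_. measure_pmf ?Q)) _ _")
proof -
  interpret M: prob_space M by fact
  have ind: "M.indep_vars (\<lambda>_. count_space UNIV) L I"
    and geo: "\<And>j. j \<in> I \<Longrightarrow> geometric_var M p (L j)"
    using assms(4) by (auto simp: iid_geometric_def)
  have [measurable]: "\<And>j. j \<in> I \<Longrightarrow> L j \<in> measurable M (count_space UNIV)"
    using geo by (auto simp: geometric_var_def)
  have "PiM I (\<lambda>_. measure_pmf ?Q) = PiM I (\<lambda>j. distr M (count_space UNIV) (L j))"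
    by (rule PiM_cong) (simp_all add: distr_geometric_var[OF assms(1-3) geo])
  also have "\<dots> = distr M (PiM I (\<lambda>_. count_space UNIV)) (\<lambda>\<omega>. \<lambda>j\<in>I. L j \<omega>)"
    using M.indep_vars_iff_distr_eq_PiM'[OF assms(5), of L "\<lambda>_. count_space UNIV"] ind
    by simp
  finally show ?thesis
    by (simp add: distr_distr comp_def)
qed

lemma prob_Suc_sum_iid_geometric_le:
  assumes "prob_space M" and "prob_space N" and "0 < p" and "p \<le> 1" and "1 \<le> k"
    and M: "iid_geometric M p L {1..k}"
    and N: "iid_geometric N p L' {1..k + 1}"
  shows "\<P>(\<omega> in N. (\<Sum>j\<in>{1..k + 1}. L' j \<omega>) \<le> n + 1) \<le> \<P>(\<omega> in M. (\<Sum>j\<in>{1..k}. L j \<omega>) \<le> n)"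
proof -
  interpret M: prob_space M by fact
  interpret N: prob_space N by fact
  have [measurable]: "\<And>j. j \<in> {1..k} \<Longrightarrow> L j \<in> measurable M (count_space UNIV)"
    using M by (auto simp: iid_geometric_def geometric_var_def)
  have N' [measurable]: "\<And>j. j \<in> {1..k + 1} \<Longrightarrow> L' j \<in> measurable N (count_space UNIV)"
    using N by (auto simp: iid_geometric_def geometric_var_def)
  have [measurable]: "\<And>j. j \<in> {1..k} \<Longrightarrow> L' j \<in> measurable N (count_space UNIV)"
    by (rule N') auto
  \<comment> \<open>A subfamily stays independent, so the first k summands on \<open>N\<close> are a
    copy of the family on \<open>M\<close>.\<close>
  have N_k: "iid_geometric N p L' {1..k}"
    using N by (auto simp: iid_geometric_def intro: N.indep_vars_subset)
  have geo: "geometric_var N p (L' (k + 1))"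
    using N by (auto simp: iid_geometric_def)
  have "AE x in distr N (count_space UNIV) (L' (k + 1)). 1 \<le> x"
    unfolding distr_geometric_var[OF assms(2-4) geo] by (auto simp: AE_measure_pmf_iff)
  then have "AE \<omega> in N. 1 \<le> L' (k + 1) \<omega>"
    by (subst (asm) AE_distr_iff) auto
  \<comment> \<open>Dropping a last summand that is at least 1 lowers the bound from n + 1 to n. The
    inclusion of events holds only outside a null set.\<close>
  then have "\<P>(\<omega> in N. (\<Sum>j\<in>{1..k + 1}. L' j \<omega>) \<le> n + 1)
      \<le> \<P>(\<omega> in N. (\<Sum>j\<in>{1..k}. L' j \<omega>) \<le> n)"
    by (intro N.finite_measure_mono_AE) (auto elim!: eventually_mono)
  also have "\<dots> = measure (distr N (count_space UNIV) (\<lambda>\<omega>. \<Sum>j\<in>{1..k}. L' j \<omega>)) {..n}"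
    by (subst measure_distr) (auto intro!: arg_cong[where f = "measure N"])
  \<comment> \<open>The passage from \<open>N\<close> to \<open>M\<close>: both laws are the same
    image of one product measure. Here 1 \<le> k makes the index set nonempty.\<close>
  also have "\<dots> = measure (distr M (count_space UNIV) (\<lambda>\<omega>. \<Sum>j\<in>{1..k}. L j \<omega>)) {..n}"
    using \<open>1 \<le> k\<close>
    by (simp only: distr_sum_iid_geometric[OF assms(1,3,4) M]
        distr_sum_iid_geometric[OF assms(2,3,4) N_k] atLeastatMost_empty_iff not_not)
  also have "\<dots> = \<P>(\<omega> in M. (\<Sum>j\<in>{1..k}. L j \<omega>) \<le> n)"
    by (subst measure_distr) (auto intro!: arg_cong[where f = "measure M"])
  finally show ?thesis .
qed

theorem mainTheorem7:
  fixes \<epsilon> t0s :: real and n k :: nat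
    and M :: "'a measure" and N :: "'b measure"
    and L :: "nat \<Rightarrow> 'a \<Rightarrow> nat" and L' :: "nat \<Rightarrow> 'b \<Rightarrow> nat"
    and B :: "'a \<Rightarrow> nat" and BB :: "'b \<Rightarrow> nat"
  assumes "0 \<le> \<epsilon>" and "\<epsilon> < 1"
    and "2 \<le> k" and "k \<le> n"
    and "prob_space M" and "prob_space N"
    and "iid_geometric M (1 - \<epsilon>) L {1..k}"
    and "iid_geometric N (1 - \<epsilon>) L' {1..k + 1}"
    and "B = (\<lambda>\<omega>. \<Sum>j\<in>{1..k}. L j \<omega>)"
    and "BB = (\<lambda>\<omega>. \<Sum>j\<in>{1..k + 1}. L' j \<omega>)"
  shows "Delta_lb M B N BB \<epsilon> n k t0s \<le> Delta_star M B \<epsilon> n k t0s"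
proof -
  let ?P = "\<P>(\<omega> in M. B \<omega> \<le> n)" and ?Q = "\<P>(\<omega> in N. BB \<omega> \<le> n + 1)"
  have "?Q \<le> ?P"
    unfolding assms(9,10) by (rule prob_Suc_sum_iid_geometric_le) (use assms in auto)
  \<comment> \<open>If \<open>?P\<close> were 0, the quotient would be 0 by the convention for
    division.\<close>
  then have "?Q / ?P \<le> 1"
    by (auto simp: divide_le_eq_1 less_le)
  \<comment> \<open>The left-hand side is the first term of \<open>Delta_lb\<close>; all other terms
    of the two expressions coincide.\<close>
  then have "real k / (1 - \<epsilon>) * (?Q / ?P) \<le> real k / (1 - \<epsilon>)"
    using assms(2) by (intro mult_left_le) auto
  then show ?thesis
    by (simp add: Delta_lb_def Delta_star_def)
qed

end
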